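(* Let $T\subset\mathbb{R}^3$ be a nondegenerate closed tetrahedron with vertices $x_1,\dots,x_4$, let $\varepsilon>0$ and let $\beta:T\to\mathbb{R}^3$ be a vector field (not necessarily constant). Let $\phi^E_{ij}$, $1\le i<j\le4$, be the $H(\mathrm{curl})$ exponentially-fitted basis functions on $T$. Then for all $1\le i<j\le 4$ and $1\le s<t\le4$, $$\phi^E_{ij}(x)\cdot t_{st}=\frac{\delta_{is,jt}}{|E_{st}|}\qquad\text{for all }x\in E_{st},$$ where $\delta_{is,jt}=1$ if $i=s$ and $j=t$, and $0$ otherwise.
   Context: $E_{st}$ is the edge joining $x_s$ and $x_t$, $|E_{st}|$ its length, $t_{st}=(x_t-x_s)/|x_t-x_s|$. For $x\in T$: $l_i:=x_i-x$, $\sigma_i:=\beta(x)\cdot l_i$, $\sigma_{ij}:=\beta(x)\cdot(x_j-x_i)$. The 2D-Bernoulli function is $$B_2^\varepsilon(a,b):=\varepsilon\,\frac{\int_0^1 e^{a y_1/\varepsilon}\,dy_1}{2\int_0^1\int_0^{1-y_2}e^{(a y_1+b y_2)/\varepsilon}\,dy_1dy_2}.$$ For each $x\in T$, the pair $(j^E_{ij}(x),\phi^E_{ij}(x))\in\mathbb{R}^3\times\mathbb{R}^3$ is defined as the unique solution of the six equations $$j^E_{ij}(x)\cdot\frac{l_s\times l_t}{2}-B_2^\varepsilon(\sigma_s,\sigma_t)\,\phi^E_{ij}(x)\cdot l_s+B_2^\varepsilon(\sigma_t,\sigma_s)\,\phi^E_{ij}(x)\cdot l_t=B_2^\varepsilon(\sigma_{st},-\sigma_s)\,\delta_{is,jt},\qquad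 1\le s<t\le4$$ (this system is uniquely solvable). *)

theory Defs
  imports "HOL-Analysis.Analysis"
begin

definition bernoulli2 :: "real \<Rightarrow> real \<Rightarrow> real \<Rightarrow> real" where
  "bernoulli2 \<epsilon> a b =
     \<epsilon> * (integral {0..1} (\<lambda>y1. exp (a * y1 / \<epsilon>)) /
       (2 * integral {0..1} (\<lambda>y2. integral {0..1 - y2} (\<lambda>y1. exp ((a * y1 + b * y2) / \<epsilon>)))))"

definition kdelta2 :: "nat \<Rightarrow> nat \<Rightarrow> nat \<Rightarrow> nat \<Rightarrow> real" where
  "kdelta2 i j s t = (if i = s \<and> j = t then 1 else 0)"

text \<open>
  The vertices of the tetrahedron are \<open>v 1, \<dots>, v 4\<close>; values of \<open>v\<close> at other indices are irrelevant.
\<close>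

definition tetrahedron :: "(nat \<Rightarrow> real ^ 3) \<Rightarrow> (real ^ 3) set" where
  "tetrahedron v = convex hull (v ` {1..4})"

definition nondegenerate :: "(nat \<Rightarrow> real ^ 3) \<Rightarrow> bool" where
  "nondegenerate v \<longleftrightarrow> inj_on v {1..4} \<and> \<not> affine_dependent (v ` {1..4})"

abbreviation edge :: "(nat \<Rightarrow> real ^ 3) \<Rightarrow> nat \<Rightarrow> nat \<Rightarrow> (real ^ 3) set" where
  "edge v s t \<equiv> closed_segment (v s) (v t)"

definition edge_length :: "(nat \<Rightarrow> real ^ 3) \<Rightarrow> nat \<Rightarrow> nat \<Rightarrow> real" where
  "edge_length v s t = dist (v s) (v t)"

definition edge_tangent :: "(nat \<Rightarrow> real ^ 3) \<Rightarrow> nat \<Rightarrow> nat \<Rightarrow> real ^ 3" where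
  "edge_tangent v s t = (v t - v s) /\<^sub>R norm (v t - v s)"

definition hcurl_system ::
    "real \<Rightarrow> (real ^ 3 \<Rightarrow> real ^ 3) \<Rightarrow> (nat \<Rightarrow> real ^ 3) \<Rightarrow> nat \<Rightarrow> nat \<Rightarrow> real ^ 3 \<Rightarrow>
     (real ^ 3) \<times> (real ^ 3) \<Rightarrow> bool" where
  "hcurl_system \<epsilon> \<beta> v i j x = (\<lambda>(J, \<phi>).
     let l = (\<lambda>k. v k - x);
         \<sigma> = (\<lambda>k. \<beta> x \<bullet> l k);
         \<sigma>2 = (\<lambda>k m. \<beta> x \<bullet> (v m - v k))
     in \<forall>s t. 1 \<le> s \<and> s < t \<and> t \<le> 4 \<longrightarrow>
          J \<bullet> (cross3 (l s) (l t) /\<^sub>R 2)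
            - bernoulli2 \<epsilon> (\<sigma> s) (\<sigma> t) * (\<phi> \<bullet> l s)
            + bernoulli2 \<epsilon> (\<sigma> t) (\<sigma> s) * (\<phi> \<bullet> l t)
          = bernoulli2 \<epsilon> (\<sigma>2 s t) (- \<sigma> s) * kdelta2 i j s t)"

text \<open>
  The fields live on the tetrahedron only: outside it they are \<open>undefined\<close>,
  and only the values of \<open>\<beta>\<close> on the tetrahedron enter.
\<close>

definition hcurl_pair ::
    "real \<Rightarrow> (real ^ 3 \<Rightarrow> real ^ 3) \<Rightarrow> (nat \<Rightarrow> real ^ 3) \<Rightarrow> nat \<Rightarrow> nat \<Rightarrow> real ^ 3 \<Rightarrow>
     (real ^ 3) \<times> (real ^ 3)" where
  "hcurl_pair \<epsilon> \<beta> v i j = (\<lambda>x\<in>tetrahedron v. THE p. hcurl_system \<epsilon> \<beta> v i j x p)"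

definition hcurl_basis ::
    "real \<Rightarrow> (real ^ 3 \<Rightarrow> real ^ 3) \<Rightarrow> (nat \<Rightarrow> real ^ 3) \<Rightarrow> nat \<Rightarrow> nat \<Rightarrow> real ^ 3 \<Rightarrow> real ^ 3" where
  "hcurl_basis \<epsilon> \<beta> v i j x = snd (hcurl_pair \<epsilon> \<beta> v i j x)"

end

theory Submission
  imports Defs
begin

text \<open>
  On the edge \<open>E\<^sub>s\<^sub>t\<close> the cross product \<open>l\<^sub>s \<times> l\<^sub>t\<close> vanishes, so the equation with
  index \<open>st\<close> only involves the tangential component of \<open>\<phi>\<close>. Writing \<open>x = x\<^sub>s + \<lambda> (x\<^sub>t - x\<^sub>s)\<close>
  and \<open>c = \<beta>(x) \<bullet> (x\<^sub>t - x\<^sub>s)\<close>, the coefficient of \<open>\<phi> \<bullet> (x\<^sub>t - x\<^sub>s)\<close> equals the one on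
  the right-hand side by the identity
  \<open>\<lambda> B(-\<lambda>c, (1-\<lambda>)c) + (1-\<lambda>) B((1-\<lambda>)c, -\<lambda>c) = B(c, \<lambda>c)\<close>.
  It holds because the integrals in \<open>B\<close> are divided differences of \<open>exp\<close>, at \<open>0, a\<close> in the
  numerator and at \<open>0, a, b\<close> in the denominator: multiplying by \<open>exp(\<lambda>c)\<close> shifts the nodes by \<open>\<lambda>c\<close>.

  The system is uniquely solvable at such \<open>x\<close>: for a homogeneous solution, the equations \<open>st\<close>,
  \<open>sk\<close> and \<open>tk\<close> combine to \<open>\<phi> \<bullet> l\<^sub>k = 0\<close> for every \<open>k\<close>, since \<open>J \<bullet> (l\<^sub>s \<times> l\<^sub>k)\<close> and
  \<open>J \<bullet> (l\<^sub>t \<times> l\<^sub>k)\<close> are proportional to \<open>-\<lambda>\<close> and \<open>1-\<lambda>\<close>. So \<open>\<phi> = 0\<close>, then \<open>J = 0\<close>.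
\<close>

section \<open>The Bernoulli function\<close>

definition exp_avg :: "real \<Rightarrow> real" where
  "exp_avg a = integral {0..1} (\<lambda>y. exp (a * y))"

definition exp_tri :: "real \<Rightarrow> real \<Rightarrow> real" where
  "exp_tri a b = integral {0..1} (\<lambda>y2. integral {0..1 - y2} (\<lambda>y1. exp (a * y1 + b * y2)))"

lemma bernoulli2_eq:
  "bernoulli2 \<epsilon> a b = \<epsilon> * (exp_avg (a / \<epsilon>) / (2 * exp_tri (a / \<epsilon>) (b / \<epsilon>)))"
  by (simp add: bernoulli2_def exp_avg_def exp_tri_def add_divide_distrib)

section \<open>Closed forms and positivity of the exponential integrals\<close>

lemma has_integral_exp_linear:
  fixes a u :: real
  assumes "a \<noteq> 0" "0 \<le> u"
  shows "((\<lambda>y. exp (a * y)) has_integral (exp (a * u) - 1) / a) {0..u}"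
proof -
  have "((\<lambda>y. exp (a * y)) has_integral (exp (a * u) / a - exp (a * 0) / a)) {0..u}"
    using assms
    by (intro fundamental_theorem_of_calculus)
       (auto intro!: derivative_eq_intros simp flip: has_real_derivative_iff_has_vector_derivative)
  thus ?thesis by (simp add: diff_divide_distrib)
qed

lemma exp_avg_0 [simp]: "exp_avg 0 = 1"
  by (simp add: exp_avg_def)

text \<open>This form avoids division and so covers a = 0; the later identities reduce to it after
  multiplying out.\<close>

lemma mult_exp_avg: "a * exp_avg a = exp a - 1"
proof (cases "a = 0")
  case False
  thus ?thesis
    using integral_unique[OF has_integral_exp_linear[of a 1]] by (simp add: exp_avg_def)
qed simp

lemma exp_avg_minus: "exp_avg (- a) = exp (- a) * exp_avg a"
proof (cases "a = 0")
  case False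
  have "a * exp_avg (- a) = a * (exp (- a) * exp_avg a)"
  proof -
    have "a * exp_avg (- a) = 1 - exp (- a)"
      using mult_exp_avg[of "- a"] by simp
    also have "\<dots> = exp (- a) * (a * exp_avg a)"
      by (simp add: mult_exp_avg right_diff_distrib flip: exp_add)
    finally show ?thesis by (simp only: mult.left_commute)
  qed
  thus ?thesis using False by simp
qed simp

lemma exp_avg_pos: "exp_avg a > 0"
proof (cases "a = 0")
  case False
  hence "exp_avg a = (exp a - 1) / a"
    using mult_exp_avg[of a] by (simp add: field_simps)
  thus ?thesis
    using False by (auto simp: zero_less_divide_iff)
qed simp

lemma inner_integral_exp:
  fixes a b y :: real
  assumes "0 \<le> y" "y \<le> 1"
  shows "integral {0..1 - y} (\<lambda>z. exp (a * z + b * y)) =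
    (if a = 0 then (1 - y) * exp (b * y) else (exp a * exp ((b - a) * y) - exp (b * y)) / a)"
proof (cases "a = 0")
  case False
  have "((\<lambda>z. exp (b * y) * exp (a * z)) has_integral
           exp (b * y) * ((exp (a * (1 - y)) - 1) / a)) {0..1 - y}"
    using has_integral_exp_linear[of a "1 - y"] False assms
    by (intro has_integral_mult_right) auto
  moreover have "exp (a * z + b * y) = exp (b * y) * exp (a * z)" for z
    by (simp flip: exp_add)
  ultimately have "integral {0..1 - y} (\<lambda>z. exp (a * z + b * y))
      = exp (b * y) * ((exp (a * (1 - y)) - 1) / a)"
    by (simp only: integral_unique)
  also have "\<dots> = (exp a * exp ((b - a) * y) - exp (b * y)) / a"
    by (simp add: right_diff_distrib algebra_simps flip: exp_add)
  finally show ?thesis using False by simp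
qed (use assms in simp)

text \<open>This is the recursion for divided differences at the nodes 0, a, b. Only a has to be
  nonzero, since \<open>exp_avg\<close> absorbs b = 0 and b = a.\<close>

lemma exp_tri_eq:
  assumes "a \<noteq> 0"
  shows "exp_tri a b = (exp a * exp_avg (b - a) - exp_avg b) / a"
proof -
  have "exp_tri a b = integral {0..1} (\<lambda>y. (exp a * exp ((b - a) * y) - exp (b * y)) / a)"
    unfolding exp_tri_def using assms
    by (intro integral_cong) (simp add: inner_integral_exp)
  also have "\<dots> = (exp a * exp_avg (b - a) - exp_avg b) / a"
    unfolding exp_avg_def
    by (subst integral_divide, subst integral_diff)
       (auto intro!: integrable_continuous_interval continuous_intros)
  finally show ?thesis .
qed

lemma exp_tri_pos: "exp_tri a b > 0"
proof -
  \<comment> \<open>A lower bound of the integrand on the triangle; as the area is 1/2, the integral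
    is at least m / 2.\<close>
  define m where "m = exp (- (\<bar>a\<bar> + \<bar>b\<bar>))"
  let ?g = "\<lambda>y. integral {0..1 - y} (\<lambda>z. exp (a * z + b * y))"
  have g: "m * (1 - y) \<le> ?g y" if y: "y \<in> {0..1}" for y
  proof -
    have "m \<le> exp (a * z + b * y)" if "z \<in> {0..1 - y}" for z
    proof -
      have "\<bar>a * z\<bar> \<le> \<bar>a\<bar>" "\<bar>b * y\<bar> \<le> \<bar>b\<bar>"
        using y that by (auto simp: abs_mult intro!: mult_left_le)
      thus ?thesis by (simp add: m_def)
    qed
    hence "integral {0..1 - y} (\<lambda>z. m) \<le> ?g y"
      by (intro integral_le integrable_continuous_interval continuous_intros) auto
    thus ?thesis using y by (simp add: mult.commute)
  qed
  \<comment> \<open>Comparing the outer integrals requires integrability of the inner one, read off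
    from its closed form.\<close>
  have "?g integrable_on {0..1}"
  proof (rule integrable_eq)
    show "(\<lambda>y. if a = 0 then (1 - y) * exp (b * y)
             else (exp a * exp ((b - a) * y) - exp (b * y)) / a) integrable_on {0..1}"
      by (cases "a = 0") (auto intro!: integrable_continuous_interval continuous_intros)
  qed (simp add: inner_integral_exp)
  hence "integral {0..1} (\<lambda>y. m * (1 - y)) \<le> exp_tri a b"
    unfolding exp_tri_def
    by (intro integral_le g) (auto intro!: integrable_continuous_interval continuous_intros)
  moreover have "((\<lambda>y. m * (1 - y)) has_integral (m * (1 - 1\<^sup>2 / 2) - m * (0 - 0\<^sup>2 / 2))) {0..1}"
    by (intro fundamental_theorem_of_calculus)
       (auto intro!: derivative_eq_intros simp flip: has_real_derivative_iff_has_vector_derivative)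
  hence "integral {0..1} (\<lambda>y. m * (1 - y)) = m / 2"
    by (subst integral_unique) auto
  ultimately have "m / 2 \<le> exp_tri a b"
    by (simp only:)
  moreover have "m > 0" by (simp add: m_def)
  ultimately show ?thesis by linarith
qed

section \<open>Shifting the nodes, and the identity for B along an edge\<close>

lemma exp_tri_shift:
  assumes "p \<noteq> 0" "p + q \<noteq> 0"
  shows "exp_tri (- p) q = exp (- p) * exp_tri (p + q) p"
proof -
  have "exp_tri (- p) q = (exp_avg q - exp (- p) * exp_avg (p + q)) / p"
    using exp_tri_eq[of "- p" q] assms(1) by (simp add: field_simps)
  moreover have "exp (- p) * exp_tri (p + q) p = (exp_avg q - exp (- p) * exp_avg p) / (p + q)"
    using exp_tri_eq[of "p + q" p] assms(2) exp_avg_minus[of q]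
    by (simp add: right_diff_distrib exp_add exp_minus)
  moreover have "(p + q) * (exp_avg q - exp (- p) * exp_avg (p + q))
                 = p * (exp_avg q - exp (- p) * exp_avg p)"
  proof -
    have "(p + q) * (exp_avg q - exp (- p) * exp_avg (p + q)) - p * (exp_avg q - exp (- p) * exp_avg p)
        = q * exp_avg q - exp (- p) * ((p + q) * exp_avg (p + q)) + exp (- p) * (p * exp_avg p)"
      by (simp add: algebra_simps)
    also have "\<dots> = 0"
      by (simp add: mult_exp_avg exp_add exp_minus field_simps)
    finally show ?thesis by simp
  qed
  ultimately show ?thesis using assms by (simp add: frac_eq_eq mult.commute)
qed

text \<open>By symmetry in the nodes this has the same value as \<open>exp_tri_shift\<close>. Since
  \<open>exp_tri_eq\<close> divides by the first argument, one version allows q = 0 and the other p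
  = 0.\<close>

lemma exp_tri_shift':
  assumes "q \<noteq> 0" "p + q \<noteq> 0"
  shows "exp_tri q (- p) = exp (- p) * exp_tri (p + q) p"
proof -
  have "exp_tri q (- p) = exp (- p) * ((exp_avg (p + q) - exp_avg p) / q)"
    using exp_tri_eq[of q "- p"] assms(1) exp_avg_minus[of p] exp_avg_minus[of "p + q"]
    by (simp add: exp_add exp_minus exp_diff field_simps)
  moreover have "exp_tri (p + q) p = (exp p * exp_avg q - exp_avg p) / (p + q)"
    using exp_tri_eq[of "p + q" p] assms(2) exp_avg_minus[of q]
    by (simp add: exp_add exp_minus)
  moreover have "(p + q) * (exp_avg (p + q) - exp_avg p) = q * (exp p * exp_avg q - exp_avg p)"
  proof -
    have "(p + q) * (exp_avg (p + q) - exp_avg p) - q * (exp p * exp_avg q - exp_avg p)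
        = (p + q) * exp_avg (p + q) - p * exp_avg p - exp p * (q * exp_avg q)"
      by (simp add: algebra_simps)
    also have "\<dots> = 0"
      by (simp add: mult_exp_avg exp_add algebra_simps)
    finally show ?thesis by simp
  qed
  ultimately show ?thesis using assms by (simp add: frac_eq_eq mult.commute)
qed

lemma bernoulli2_pos: "\<epsilon> > 0 \<Longrightarrow> bernoulli2 \<epsilon> a b > 0"
  by (simp add: bernoulli2_eq exp_avg_pos exp_tri_pos)

text \<open>Times c, both sides are the integral of exp from -rc to (1 - r)c; the left side splits
  it at 0.\<close>

lemma exp_avg_edge:
  assumes "c \<noteq> 0"
  shows "r * exp_avg (- (r * c)) + (1 - r) * exp_avg ((1 - r) * c) = exp (- (r * c)) * exp_avg c"
proof -
  have "c * (r * exp_avg (- (r * c)) + (1 - r) * exp_avg ((1 - r) * c))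
      = - (- (r * c) * exp_avg (- (r * c))) + (1 - r) * c * exp_avg ((1 - r) * c)"
    by (simp add: algebra_simps)
  also have "\<dots> = exp ((1 - r) * c) - exp (- (r * c))"
    by (simp only: mult_exp_avg)
  also have "\<dots> = exp (- (r * c)) * (c * exp_avg c)"
    by (simp add: mult_exp_avg right_diff_distrib algebra_simps flip: exp_add)
  finally show ?thesis using assms by (simp add: mult.left_commute)
qed

lemma bernoulli2_edge:
  assumes "\<epsilon> > 0"
  shows "r * bernoulli2 \<epsilon> (- (r * c)) ((1 - r) * c) + (1 - r) * bernoulli2 \<epsilon> ((1 - r) * c) (- (r * c))
         = bernoulli2 \<epsilon> c (r * c)"
proof (cases "c = 0")
  case False
  define d where "d = c / \<epsilon>"
  define D where "D = exp_tri d (r * d)"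
  have d: "d \<noteq> 0" using False assms by (simp add: d_def)
  have D: "D > 0" by (simp add: D_def exp_tri_pos)
  have sum: "r * d + (1 - r) * d = d" by (simp add: algebra_simps)
  have 1: "r * bernoulli2 \<epsilon> (- (r * c)) ((1 - r) * c)
         = \<epsilon> * (r * exp_avg (- (r * d)) / (2 * (exp (- (r * d)) * D)))"
  proof (cases "r = 0")
    case False
    thus ?thesis
      using exp_tri_shift[of "r * d" "(1 - r) * d"] d
      by (simp add: bernoulli2_eq sum D_def) (simp add: d_def)
  qed simp
  have 2: "(1 - r) * bernoulli2 \<epsilon> ((1 - r) * c) (- (r * c))
         = \<epsilon> * ((1 - r) * exp_avg ((1 - r) * d) / (2 * (exp (- (r * d)) * D)))"
  proof (cases "r = 1")
    case False
    thus ?thesis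
      using exp_tri_shift'[of "(1 - r) * d" "r * d"] d
      by (simp add: bernoulli2_eq sum D_def) (simp add: d_def)
  qed simp
  have "r * bernoulli2 \<epsilon> (- (r * c)) ((1 - r) * c) + (1 - r) * bernoulli2 \<epsilon> ((1 - r) * c) (- (r * c))
      = \<epsilon> * ((r * exp_avg (- (r * d)) + (1 - r) * exp_avg ((1 - r) * d)) / (2 * (exp (- (r * d)) * D)))"
    unfolding 1 2 by (simp add: add_divide_distrib distrib_left)
  also have "\<dots> = \<epsilon> * (exp_avg d / (2 * D))"
    unfolding exp_avg_edge[OF d] by simp
  also have "\<dots> = bernoulli2 \<epsilon> c (r * c)"
    by (simp add: bernoulli2_eq D_def d_def)
  finally show ?thesis .
\<comment> \<open>For c = 0 all three values of B agree and the weights r and 1 - r add up to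
  1.\<close>
qed (simp add: algebra_simps)

section \<open>Solvability of the system on an edge\<close>

text \<open>Left side of one equation, taken for arbitrary k and m so that the kernel argument need
  not order its indices.\<close>

definition hcurl_row ::
    "real \<Rightarrow> (real ^ 3 \<Rightarrow> real ^ 3) \<Rightarrow> (nat \<Rightarrow> real ^ 3) \<Rightarrow> real ^ 3 \<Rightarrow> nat \<Rightarrow> nat \<Rightarrow>
     (real ^ 3) \<times> (real ^ 3) \<Rightarrow> real" where
  "hcurl_row \<epsilon> \<beta> v x k m p =
     fst p \<bullet> (cross3 (v k - x) (v m - x) /\<^sub>R 2)
     - bernoulli2 \<epsilon> (\<beta> x \<bullet> (v k - x)) (\<beta> x \<bullet> (v m - x)) * (snd p \<bullet> (v k - x))
     + bernoulli2 \<epsilon> (\<beta> x \<bullet> (v m - x)) (\<beta> x \<bullet> (v k - x)) * (snd p \<bullet> (v m - x))"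

lemma hcurl_system_iff:
  "hcurl_system \<epsilon> \<beta> v i j x p \<longleftrightarrow>
    (\<forall>s t. 1 \<le> s \<and> s < t \<and> t \<le> 4 \<longrightarrow> hcurl_row \<epsilon> \<beta> v x s t p =
       bernoulli2 \<epsilon> (\<beta> x \<bullet> (v t - v s)) (- (\<beta> x \<bullet> (v s - x))) * kdelta2 i j s t)"
  by (simp add: hcurl_system_def hcurl_row_def Let_def split_beta)

lemma hcurl_row_swap: "hcurl_row \<epsilon> \<beta> v x m k p = - hcurl_row \<epsilon> \<beta> v x k m p"
  using cross_skew[of "v m - x" "v k - x"] by (simp add: hcurl_row_def)

lemma linear_hcurl_row: "linear (hcurl_row \<epsilon> \<beta> v x k m)"
  by (rule linearI) (simp_all add: hcurl_row_def inner_add_left algebra_simps)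

section \<open>The equations at a point of an edge\<close>

lemma edge_vertex_diffs:
  fixes v :: "nat \<Rightarrow> real ^ 3"
  assumes "x = (1 - r) *\<^sub>R v s + r *\<^sub>R v t"
  shows "v s - x = - r *\<^sub>R (v t - v s)" "v t - x = (1 - r) *\<^sub>R (v t - v s)"
  using assms by (simp_all add: algebra_simps)

lemma hcurl_row_edge:
  assumes "\<epsilon> > 0" and x: "x = (1 - r) *\<^sub>R v s + r *\<^sub>R v t"
  shows "hcurl_row \<epsilon> \<beta> v x s t p =
    bernoulli2 \<epsilon> (\<beta> x \<bullet> (v t - v s)) (- (\<beta> x \<bullet> (v s - x))) * (snd p \<bullet> (v t - v s))"
proof -
  define c where "c = \<beta> x \<bullet> (v t - v s)"
  have cross: "cross3 (v s - x) (v t - x) = 0"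
    unfolding edge_vertex_diffs[OF x] by (simp add: cross_mult_left cross_mult_right)
  have "hcurl_row \<epsilon> \<beta> v x s t p =
      (r * bernoulli2 \<epsilon> (- (r * c)) ((1 - r) * c) + (1 - r) * bernoulli2 \<epsilon> ((1 - r) * c) (- (r * c)))
      * (snd p \<bullet> (v t - v s))"
    unfolding hcurl_row_def cross
    unfolding edge_vertex_diffs[OF x] inner_scaleR_right c_def[symmetric]
    by (simp add: algebra_simps)
  also have "r * bernoulli2 \<epsilon> (- (r * c)) ((1 - r) * c) + (1 - r) * bernoulli2 \<epsilon> ((1 - r) * c) (- (r * c))
      = bernoulli2 \<epsilon> c (r * c)"
    by (rule bernoulli2_edge[OF assms(1)])
  also have "r * c = - (\<beta> x \<bullet> (v s - x))"
    unfolding edge_vertex_diffs[OF x] c_def by simp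
  finally show ?thesis by (simp add: c_def)
qed

section \<open>Trivial kernel and unique solvability\<close>

lemma nondegenerate_orthogonal_eq_0:
  assumes "nondegenerate v" and orth: "\<And>k. k \<in> {1..4} \<Longrightarrow> w \<bullet> (v k - x) = 0"
  shows "w = 0"
proof -
  have "card (v ` {1..4}) = Suc DIM(real ^ 3)"
    using assms(1) by (simp add: nondegenerate_def card_image)
  \<comment> \<open>The vertices span the whole space affinely, so the affine set of all y with w
    orthogonal to y - x contains x + w.\<close>
  hence "affine hull (v ` {1..4}) = UNIV"
    using assms(1) by (intro affine_independent_span_eq) (auto simp: nondegenerate_def)
  moreover have "affine hull (v ` {1..4}) \<subseteq> {y. w \<bullet> y = w \<bullet> x}"
    by (rule hull_minimal) (use orth in \<open>auto simp: inner_diff_right affine_hyperplane\<close>)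
  ultimately have "w \<bullet> (x + w) = w \<bullet> x" by blast
  thus ?thesis by (simp add: inner_add_right)
qed

text \<open>Cycling the triple product allows \<open>nondegenerate_orthogonal_eq_0\<close> to be
  used twice: first J is parallel to every edge vector from x, then to every u.\<close>

lemma nondegenerate_cross_eq_0:
  assumes "nondegenerate v"
    and orth: "\<And>k m. k \<in> {1..4} \<Longrightarrow> m \<in> {1..4} \<Longrightarrow> J \<bullet> cross3 (v k - x) (v m - x) = 0"
  shows "J = 0"
proof -
  have par: "cross3 J (v k - x) = 0" if "k \<in> {1..4}" for k
    by (rule nondegenerate_orthogonal_eq_0[OF assms(1), where x = x])
       (use orth[OF that] in \<open>metis cross_triple inner_commute\<close>)
  have "cross3 u J = 0" for u
    by (rule nondegenerate_orthogonal_eq_0[OF assms(1), where x = x])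
       (use par in \<open>metis cross_triple inner_commute inner_zero_right\<close>)
  from this[of "axis 1 1"] this[of "axis 2 1"] show ?thesis
    by (simp add: cross3_def vec_eq_iff forall_3 axis_def)
qed

lemma hcurl_row_kernel:
  assumes nd: "nondegenerate v" and \<epsilon>: "\<epsilon> > 0"
    and st: "s \<in> {1..4}" "t \<in> {1..4}"
    and r: "0 \<le> r" "r \<le> 1" and x: "x = (1 - r) *\<^sub>R v s + r *\<^sub>R v t"
    and row: "\<And>k m. k \<in> {1..4} \<Longrightarrow> m \<in> {1..4} \<Longrightarrow> hcurl_row \<epsilon> \<beta> v x k m p = 0"
  shows "p = 0"
proof -
  obtain J \<phi> where p: "p = (J, \<phi>)" by (cases p)
  let ?B = "\<lambda>k m. bernoulli2 \<epsilon> (\<beta> x \<bullet> (v k - x)) (\<beta> x \<bullet> (v m - x))"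
  have e: "\<phi> \<bullet> (v t - v s) = 0"
    using row[OF st] bernoulli2_pos[OF \<epsilon>] unfolding hcurl_row_edge[OF \<epsilon> x]
    by (simp add: p less_imp_neq[symmetric])
  have "\<phi> = 0"
  proof (rule nondegenerate_orthogonal_eq_0[OF nd])
    fix k :: nat assume k: "k \<in> {1..4}"
    \<comment> \<open>Both vectors from x to the ends of the edge are multiples of v t - v s, so the
      rows s k and t k share this one unknown.\<close>
    define X where "X = J \<bullet> (cross3 (v t - v s) (v k - x) /\<^sub>R 2)"
    have s0: "- r * X + ?B k s * (\<phi> \<bullet> (v k - x)) = 0"
    proof -
      have "\<phi> \<bullet> (v s - x) = 0"
        unfolding edge_vertex_diffs[OF x] using e by simp
      moreover have "J \<bullet> (cross3 (v s - x) (v k - x) /\<^sub>R 2) = - r * X"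
        unfolding edge_vertex_diffs[OF x] X_def by (simp add: cross_mult_left)
      ultimately show ?thesis using row[OF st(1) k] by (simp add: hcurl_row_def p)
    qed
    have t0: "(1 - r) * X + ?B k t * (\<phi> \<bullet> (v k - x)) = 0"
    proof -
      have "\<phi> \<bullet> (v t - x) = 0"
        unfolding edge_vertex_diffs[OF x] using e by simp
      moreover have "J \<bullet> (cross3 (v t - x) (v k - x) /\<^sub>R 2) = (1 - r) * X"
        unfolding edge_vertex_diffs[OF x] X_def by (simp add: cross_mult_left)
      ultimately show ?thesis using row[OF st(2) k] by (simp add: hcurl_row_def p)
    qed
    \<comment> \<open>The weights 1 - r and r cancel X and leave a positive coefficient.\<close>
    have "((1 - r) * ?B k s + r * ?B k t) * (\<phi> \<bullet> (v k - x))
        = (1 - r) * (- r * X + ?B k s * (\<phi> \<bullet> (v k - x)))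
          + r * ((1 - r) * X + ?B k t * (\<phi> \<bullet> (v k - x)))"
      by (simp add: algebra_simps)
    also have "\<dots> = 0" by (simp only: s0 t0)
    finally have "((1 - r) * ?B k s + r * ?B k t) * (\<phi> \<bullet> (v k - x)) = 0" .
    moreover have "(1 - r) * ?B k s + r * ?B k t > 0"
    proof (cases "r = 0")
      case False
      thus ?thesis using r bernoulli2_pos[OF \<epsilon>]
        by (intro add_nonneg_pos mult_nonneg_nonneg mult_pos_pos) (auto intro: less_imp_le)
    qed (simp add: bernoulli2_pos[OF \<epsilon>])
    ultimately show "\<phi> \<bullet> (v k - x) = 0" by simp
  qed
  moreover from this have "J = 0"
    by (intro nondegenerate_cross_eq_0[OF nd]) (use row in \<open>simp add: hcurl_row_def p\<close>)
  ultimately show ?thesis by (simp add: p zero_prod_def)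
qed

lemma pairs_below_5:
  "(\<forall>k m::nat. 1 \<le> k \<and> k < m \<and> m \<le> 4 \<longrightarrow> P k m)
    \<longleftrightarrow> P 1 2 \<and> P 1 3 \<and> P 1 4 \<and> P 2 3 \<and> P 2 4 \<and> P 3 4"
proof -
  have "1 \<le> k \<and> k < m \<and> m \<le> 4 \<longleftrightarrow> (k, m) \<in> {(1,2),(1,3),(1,4),(2,3),(2,4),(3,4)}" for k m :: nat
    by auto
  thus ?thesis by auto
qed

lemma hcurl_system_ex1:
  assumes nd: "nondegenerate v" and \<epsilon>: "\<epsilon> > 0"
    and st: "s \<in> {1..4}" "t \<in> {1..4}" and x: "x \<in> edge v s t"
  shows "\<exists>!p. hcurl_system \<epsilon> \<beta> v i j x p"
proof -
  define R where "R = hcurl_row \<epsilon> \<beta> v x"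
  \<comment> \<open>Collecting the six rows into an endomorphism of a six-dimensional space makes
    injectivity imply bijectivity.\<close>
  define f :: "(real ^ 3) \<times> (real ^ 3) \<Rightarrow> (real ^ 3) \<times> (real ^ 3)"
    where "f p = (vector [R 1 2 p, R 1 3 p, R 1 4 p], vector [R 2 3 p, R 2 4 p, R 3 4 p])" for p
  have f_eq: "f p = (vector [a12, a13, a14], vector [a23, a24, a34]) \<longleftrightarrow>
      R 1 2 p = a12 \<and> R 1 3 p = a13 \<and> R 1 4 p = a14 \<and> R 2 3 p = a23 \<and> R 2 4 p = a24 \<and> R 3 4 p = a34"
    for p a12 a13 a14 a23 a24 a34
    by (auto simp: f_def vec_eq_iff forall_3)
  have R: "linear (R k m)" for k m
    by (simp add: R_def linear_hcurl_row)
  have "linear f"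
    by (rule linearI)
       (auto simp: f_def vec_eq_iff forall_3 linear_add[OF R] linear_cmul[OF R])
  moreover have "p = 0" if "f p = 0" for p
  proof -
    have "f p = (vector [0, 0, 0], vector [0, 0, 0])"
      using that by (simp add: zero_prod_def vec_eq_iff forall_3)
    hence upper: "\<forall>k m. 1 \<le> k \<and> k < m \<and> m \<le> 4 \<longrightarrow> R k m p = 0"
      unfolding f_eq pairs_below_5 .
    \<comment> \<open>The other index pairs follow by antisymmetry; a diagonal row vanishes
      identically.\<close>
    have "R k m p = 0" if "k \<in> {1..4}" "m \<in> {1..4}" for k m
    proof (cases k m rule: linorder_cases)
      case greater
      hence "R m k p = 0" using upper that by simp
      thus ?thesis by (simp add: R_def hcurl_row_swap[of \<epsilon> \<beta> v x k m])
    qed (use upper that in \<open>simp_all add: R_def hcurl_row_def\<close>)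
    moreover obtain r where "0 \<le> r" "r \<le> 1" "x = (1 - r) *\<^sub>R v s + r *\<^sub>R v t"
      using x by (auto simp: in_segment)
    ultimately show ?thesis
      using hcurl_row_kernel[OF nd \<epsilon> st] unfolding R_def by blast
  qed
  ultimately have "inj f" and "surj f"
    using linear_injective_0 linear_injective_imp_surjective by blast+
  hence "\<exists>!p. f p = y" for y
    by (metis bijI bij_iff)
  thus ?thesis
    unfolding hcurl_system_iff pairs_below_5 R_def[symmetric] f_eq[symmetric] .
qed

section \<open>Tangential traces\<close>

theorem lemma3p2:
  fixes v :: "nat \<Rightarrow> real ^ 3"
    and \<epsilon> :: real
    and \<beta> :: "real ^ 3 \<Rightarrow> real ^ 3"
    and i j s t :: nat
  assumes "nondegenerate v"
    and "\<epsilon> > 0"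
    and "1 \<le> i" "i < j" "j \<le> 4"
    and "1 \<le> s" "s < t" "t \<le> 4"
  shows "\<forall>x \<in> edge v s t.
           hcurl_basis \<epsilon> \<beta> v i j x \<bullet> edge_tangent v s t = kdelta2 i j s t / edge_length v s t"
proof
  fix x assume x: "x \<in> edge v s t"
  have st: "s \<in> {1..4}" "t \<in> {1..4}" using assms by auto
  define p where "p = (THE p. hcurl_system \<epsilon> \<beta> v i j x p)"
  \<comment> \<open>Outside the tetrahedron \<open>hcurl_pair\<close> is
    \<open>undefined\<close>.\<close>
  have "x \<in> tetrahedron v"
    using x st hull_mono[of "{v s, v t}" "v ` {1..4}" convex]
    by (auto simp: tetrahedron_def segment_convex_hull)
  hence basis: "hcurl_basis \<epsilon> \<beta> v i j x = snd p"
    by (simp add: hcurl_basis_def hcurl_pair_def p_def)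
  have "hcurl_system \<epsilon> \<beta> v i j x p"
    unfolding p_def using hcurl_system_ex1[OF assms(1,2) st x] by (rule theI')
  hence "hcurl_row \<epsilon> \<beta> v x s t p =
      bernoulli2 \<epsilon> (\<beta> x \<bullet> (v t - v s)) (- (\<beta> x \<bullet> (v s - x))) * kdelta2 i j s t"
    using assms by (simp add: hcurl_system_iff)
  moreover obtain r where "x = (1 - r) *\<^sub>R v s + r *\<^sub>R v t"
    using x by (auto simp: in_segment)
  \<comment> \<open>The same positive value of B stands on both sides and cancels.\<close>
  ultimately have "snd p \<bullet> (v t - v s) = kdelta2 i j s t"
    using bernoulli2_pos[OF assms(2)] by (simp add: hcurl_row_edge[OF assms(2)] less_imp_neq[symmetric])
  thus "hcurl_basis \<epsilon> \<beta> v i j x \<bullet> edge_tangent v s t = kdelta2 i j s t / edge_length v s t"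
    by (simp add: basis edge_tangent_def edge_length_def dist_norm norm_minus_commute divide_inverse
        mult.commute)
qed

end
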